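(* Let $p,q$ be odd integers with $0<q<p$ and $\gcd(p,q)=1$, let $l=\lceil\log_2(p)\rceil$, let $A=\{q_1,\ldots,q_l\}$ be a successive minimum $(p,q)$-mediated sequence (sorted as in the definition of successive), and let $T$ be the binary tree representation of $A$. Then the following hold: (1) The height of $T$ is $\lceil\log_2(p)\rceil$; (2) any leaf node of $T$ is labelled by either $p$ or $q$; (3) the root node of $T$ is labelled by $q$; (4) the root node of the left subtree of $T$ of height $i$ is labelled by $q_i$; (5) any right subtree of $T$ either is a leaf node or coincides with some left subtree; (6) the label of any non-leaf node is the average of the labels of its children, or half of the label of its child if there is only one child; (7) $\sum_{j\in p(T)}2^j=q$ and $\sum_{j\in q(T)}2^j=2^{\lceil\log_2(p)\rceil}-p$.
   Context: Given an integer $p>0$, a set of nonnegative integers $A$ is a $p$-mediated sequence if every number in $A$ is the average of two distinct numbers in $A\cup\{0,p\}$; a $(p,q)$-mediated sequence is a $p$-mediated sequence containing $q$; it is minimum if it has the smallest cardinality among $(p,q)$-mediated sequences (when $\gcd(p,q)=1$ this cardinality is $l=\lceil\log_2(p)\rceil$). For integers $0<q<p$ with $\gcd(p,q)=1$, a minimum $(p,q)$-mediated sequence $A=\{q_1,\ldots,q_l\}$ with $l=\lceil\log_2(p)\rceil$ is successive if it can be sorted so that $q_i=\frac{q_{i-1}+t_i}{2}$ for $i=1,\ldots,l$ and $q_l=q$, where $t_i\in\{0,p,q,q_1,\ldots,q_{i-2}\}$ for $i=1,\ldots,l$ and $q_0\in\{p,q\}$. (When $p,q$ are both odd, $q_1=\frac{p+q}{2}$.)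 Binary tree representation ($p,q$ odd). $T_1$ is the binary tree with a root labelled $q_1$ and two children labelled $p$ and $q$ (left and right respectively). For $2\le i\le l$, $T_i$ is obtained by adding a new root labelled $q_i$ whose left subtree is $T_{i-1}$, and: with no right child if $q_i=\frac{q_{i-1}}{2}$; with right child a leaf labelled $p$ if $q_i=\frac{q_{i-1}+p}{2}$; with right child a leaf labelled $q$ if $q_i=\frac{q_{i-1}+q}{2}$; with right subtree (a copy of) $T_j$ if $q_i=\frac{q_{i-1}+q_j}{2}$, $1\le j\le i-2$. The tree $T=T_l$ is the binary tree representation of $A$. Heights: the height of a node is measured from the bottom of the tree, i.e. the nodes at the bottom level have height $0$ and each child has height one less than its parent; the height of $T$, or of a subtree, is the height of its root node. An only child is regarded as a left child. The left subtree of $T$ of height $i$ ($1\le i\le l$) is the subtree whose root is reached from the root of $T$ by following $l-i$ successive left edges. A right subtree of $T$ is a subtree rooted at the right child of some node; "coincides" means equal as labelled binary trees. $p(T)$ (resp. $q(T)$) denotes the collection of heights of the leaf nodes of $T$ labelled $p$ (resp. $q$), counted with multiplicity (one entry for each such leaf). *)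

theory Defs
  imports Complex_Main "HOL-Library.Multiset" "HOL-Library.Tree"
begin

definition mediated :: "nat \<Rightarrow> nat set \<Rightarrow> bool" where
  "mediated p A \<longleftrightarrow>
     (\<forall>a\<in>A. \<exists>x\<in>A \<union> {0, p}. \<exists>y\<in>A \<union> {0, p}. x \<noteq> y \<and> 2 * a = x + y)"

definition mediated_containing :: "nat \<Rightarrow> nat \<Rightarrow> nat set \<Rightarrow> bool" where
  "mediated_containing p q A \<longleftrightarrow> mediated p A \<and> q \<in> A"

text \<open>Infinite sets can be mediated (the positive integers are), and \<^const>\<open>card\<close> maps them
  to 0, so both sides of the comparison are restricted to finite sets. For \<open>0 < q < p\<close> nothing is
  lost: \<open>{1..<p}\<close> is a finite competitor.\<close>

definition minimum_mediated :: "nat \<Rightarrow> nat \<Rightarrow> nat set \<Rightarrow> bool" where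
  "minimum_mediated p q A \<longleftrightarrow>
     finite A \<and> mediated_containing p q A \<and>
     (\<forall>B. finite B \<and> mediated_containing p q B \<longrightarrow> card A \<le> card B)"

text \<open>The enumeration is \<open>s 1, \<dots>, s l\<close>; the value \<open>s 0\<close> is the auxiliary starting point
  and is not itself listed as an element of \<open>A\<close>.\<close>

definition successive_sorting :: "nat \<Rightarrow> nat \<Rightarrow> nat set \<Rightarrow> (nat \<Rightarrow> nat) \<Rightarrow> bool" where
  "successive_sorting p q A s \<longleftrightarrow>
     (let l = nat \<lceil>log 2 (real p)\<rceil> in
        minimum_mediated p q A \<and>
        bij_betw s {1..l} A \<and>
        s 0 \<in> {p, q} \<and>
        s l = q \<and>
        (\<forall>i\<in>{1..l}. \<exists>t\<in>{0, p, q} \<union> s ` {j. 1 \<le> j \<and> j + 2 \<le> i}. 2 * s i = s (i - 1) + t))"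

text \<open>Labelled binary trees are represented by \<^typ>\<open>nat tree\<close>, in which the constructor
  \<^const>\<open>Leaf\<close> stands for an absent child; a leaf node in the usual sense is
  \<^term>\<open>leaf_node x\<close>.\<close>

definition leaf_node :: "'a \<Rightarrow> 'a tree" where
  "leaf_node x = Node Leaf x Leaf"

definition root_labelled :: "'a tree \<Rightarrow> 'a \<Rightarrow> bool" where
  "root_labelled T x \<longleftrightarrow> (\<exists>L R. T = Node L x R)"

text \<open>\<open>rep_tree p q s i T\<close> says that \<open>T\<close> is the \<open>i\<close>-th tree \<open>T\<^sub>i\<close> of the construction.\<close>

inductive rep_tree :: "nat \<Rightarrow> nat \<Rightarrow> (nat \<Rightarrow> nat) \<Rightarrow> nat \<Rightarrow> nat tree \<Rightarrow> bool"
  for p q :: nat and s :: "nat \<Rightarrow> nat"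
where
  base: "rep_tree p q s 1 (Node (leaf_node p) (s 1) (leaf_node q))"
| half: "rep_tree p q s i T \<Longrightarrow> 2 * s (i + 1) = s i \<Longrightarrow>
    rep_tree p q s (i + 1) (Node T (s (i + 1)) Leaf)"
| avg_p: "rep_tree p q s i T \<Longrightarrow> 2 * s (i + 1) = s i + p \<Longrightarrow>
    rep_tree p q s (i + 1) (Node T (s (i + 1)) (leaf_node p))"
| avg_q: "rep_tree p q s i T \<Longrightarrow> 2 * s (i + 1) = s i + q \<Longrightarrow>
    rep_tree p q s (i + 1) (Node T (s (i + 1)) (leaf_node q))"
| avg_tree: "rep_tree p q s i T \<Longrightarrow> 1 \<le> j \<Longrightarrow> j + 1 \<le> i \<Longrightarrow> rep_tree p q s j S \<Longrightarrow>
    2 * s (i + 1) = s i + s j \<Longrightarrow>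
    rep_tree p q s (i + 1) (Node T (s (i + 1)) S)"

text \<open>For a sequence sorted as above, each \<open>T\<^sub>i\<close> exists and is unique, although the relation is
  not functional for arbitrary \<open>s\<close>.\<close>

lemma mediated_bounds:
  assumes "finite A" "mediated p A" "a \<in> A" "0 < p"
  shows "0 < a" "a < p"
proof -
  have "\<exists>x\<in>A \<union> {0, p}. \<exists>y\<in>A \<union> {0, p}. x \<noteq> y \<and> 2 * a = x + y"
    using assms by (auto simp: mediated_def)
  then show "0 < a" by auto
  let ?M = "Max A"
  have M: "?M \<in> A" using assms(1,3) by (auto intro: Max_in)
  have le: "\<And>z. z \<in> A \<Longrightarrow> z \<le> ?M" using assms by auto
  have "?M < p"
  proof (rule ccontr)
    assume "\<not> ?M < p"
    obtain x y where xy: "x \<in> A \<union> {0, p}" "y \<in> A \<union> {0, p}" "x \<noteq> y" "2 * ?M = x + y"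
      using assms(2) M unfolding mediated_def by blast
    have "x \<le> ?M" "y \<le> ?M" using xy(1,2) le \<open>\<not> ?M < p\<close> by auto
    then show False using xy(3,4) by linarith
  qed
  then show "a < p" using le[OF assms(3)] by linarith
qed

lemma rep_tree_ex1:
  assumes "0 < q" "q < p" "successive_sorting p q A s"
    and "1 \<le> i" "i \<le> nat \<lceil>log 2 (real p)\<rceil>"
  shows "\<exists>!T. rep_tree p q s i T"
  using assms(4,5)
proof (induction i rule: less_induct)
  case (less i)
  define l where "l = nat \<lceil>log 2 (real p)\<rceil>"
  note sorting = assms(3)[unfolded successive_sorting_def Let_def, folded l_def]
  have il: "1 \<le> i" "i \<le> l" using less.prems by (auto simp: l_def)
  have inj: "inj_on s {1..l}" and img: "s ` {1..l} = A"
    using sorting by (auto simp: bij_betw_def)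
  have bounds: "0 < s j \<and> s j < p" if "1 \<le> j" "j \<le> l" for j
  proof -
    have "s j \<in> A" using that img by auto
    then show ?thesis
      using mediated_bounds[of A p "s j"] sorting assms(1,2)
      by (auto simp: minimum_mediated_def mediated_containing_def)
  qed
  have sl: "s l = q" using sorting by simp
  have neq: "s j \<noteq> q" if "1 \<le> j" "j < l" for j
    using inj_onD[OF inj, of j l] that sl by auto
  have pos: "1 \<le> j" if "rep_tree p q s j T" for j T
    using that by cases auto
  show ?case
  proof (cases "i = 1")
    case True
    show ?thesis
    proof
      show "rep_tree p q s i (Node (leaf_node p) (s 1) (leaf_node q))"
        using True by (simp add: base[unfolded One_nat_def])
    next
      fix T assume "rep_tree p q s i T"
      then show "T = Node (leaf_node p) (s 1) (leaf_node q)"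
      proof cases
        case base then show ?thesis by simp
      qed (use True pos in fastforce)+
    qed
  next
    case False
    then obtain k where k: "i = k + 1" "1 \<le> k" "k < l"
      using il that[of "i - 1"] by auto
    have IH: "\<exists>!T. rep_tree p q s j T" if "1 \<le> j" "j \<le> k" for j
      using less.IH[of j] that k less.prems by auto
    obtain t where t: "t \<in> {0, p, q} \<union> s ` {j. 1 \<le> j \<and> j + 2 \<le> i}" "2 * s i = s (i - 1) + t"
      using sorting il by (meson atLeastAtMost_iff)
    have step: "\<exists>S. T = Node U (s i) S \<and> rep_tree p q s k U \<and>
        (2 * s i = s k \<and> S = Leaf \<or> 2 * s i = s k + p \<and> S = leaf_node p \<or>
         2 * s i = s k + q \<and> S = leaf_node q \<or>
         (\<exists>j. 1 \<le> j \<and> j + 1 \<le> k \<and> rep_tree p q s j S \<and> 2 * s i = s k + s j))"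
      if "rep_tree p q s i T" "rep_tree p q s k U" for T U
      using that(1)
    proof cases
      case base then show ?thesis using k by simp
    next
      case (half i' T')
      then show ?thesis using k IH[of k] that(2) by auto
    next
      case (avg_p i' T')
      then show ?thesis using k IH[of k] that(2) by auto
    next
      case (avg_q i' T')
      then show ?thesis using k IH[of k] that(2) by auto
    next
      case (avg_tree i' T' j S)
      then show ?thesis using k IH[of k] that(2) by auto
    qed
    obtain U where U: "rep_tree p q s k U" using IH[of k] k by auto
    have ex: "\<exists>T. rep_tree p q s i T"
    proof -
      have "t = 0 \<or> t = p \<or> t = q \<or> (\<exists>j. 1 \<le> j \<and> j + 1 \<le> k \<and> t = s j)"
        using t(1) k by auto
      moreover have "2 * s (k + 1) = s k + t" using t(2) k by simp
      moreover have "\<exists>S. rep_tree p q s j S" if "1 \<le> j" "j + 1 \<le> k" for j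
        using IH[of j] that by auto
      ultimately show ?thesis
        using rep_tree.half[OF U] rep_tree.avg_p[OF U] rep_tree.avg_q[OF U]
          rep_tree.avg_tree[OF U] unfolding k(1) by (elim disjE) (simp, blast+)
    qed
    have uniq: "T = T'" if T: "rep_tree p q s i T" and T': "rep_tree p q s i T'" for T T'
    proof -
      obtain S S' where S: "T = Node U (s i) S" "T' = Node U (s i) S'"
        and cS: "2 * s i = s k \<and> S = Leaf \<or> 2 * s i = s k + p \<and> S = leaf_node p \<or>
         2 * s i = s k + q \<and> S = leaf_node q \<or>
         (\<exists>j. 1 \<le> j \<and> j + 1 \<le> k \<and> rep_tree p q s j S \<and> 2 * s i = s k + s j)"
        and cS': "2 * s i = s k \<and> S' = Leaf \<or> 2 * s i = s k + p \<and> S' = leaf_node p \<or>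
         2 * s i = s k + q \<and> S' = leaf_node q \<or>
         (\<exists>j. 1 \<le> j \<and> j + 1 \<le> k \<and> rep_tree p q s j S' \<and> 2 * s i = s k + s j)"
        using step[OF T U] step[OF T' U] by blast
      have b: "0 < s j \<and> s j < p \<and> s j \<noteq> q" if "1 \<le> j" "j + 1 \<le> k" for j
        using bounds[of j] neq[of j] that k by auto
      have same: "j = j'" if "1 \<le> j" "j + 1 \<le> k" "1 \<le> j'" "j' + 1 \<le> k" "s j = s j'" for j j'
        using inj_onD[OF inj, of j j'] that k by auto
      have "S = S'"
      proof (cases "\<exists>j. 1 \<le> j \<and> j + 1 \<le> k \<and> 2 * s i = s k + s j")
        case True
        then obtain j where j: "1 \<le> j" "j + 1 \<le> k" "2 * s i = s k + s j" by blast
        have none: "2 * s i \<noteq> s k" "2 * s i \<noteq> s k + p" "2 * s i \<noteq> s k + q"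
          using j b[of j] by auto
        have "rep_tree p q s j S" using cS none same[of j] j by auto
        moreover have "rep_tree p q s j S'" using cS' none same[of j] j by auto
        ultimately
        show ?thesis using IH[of j] j by auto
      next
        case False
        then show ?thesis using cS cS' assms(1,2) by auto
      qed
      then show ?thesis using S by simp
    qed
    show ?thesis using ex uniq by blast
  qed
qed

text \<open>The library's \<^const>\<open>height\<close> counts nodes on a longest path from the root, here edges are
  counted.\<close>

definition tree_height :: "'a tree \<Rightarrow> nat" where
  "tree_height T = height T - 1"

definition left_subtree :: "nat \<Rightarrow> 'a tree \<Rightarrow> nat \<Rightarrow> 'a tree" where
  "left_subtree l T i = (left ^^ (l - i)) T"

definition right_subtrees :: "'a tree \<Rightarrow> 'a tree set" where
  "right_subtrees T = {R. R \<noteq> Leaf \<and> (\<exists>L x. Node L x R \<in> subtrees T)}"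

text \<open>Heights of the leaf nodes labelled \<open>x\<close>, given the height \<open>h\<close> of the root. The subtraction
  never truncates when \<open>h\<close> is at least the height of the tree.\<close>

primrec leaf_heights_from :: "'a \<Rightarrow> nat \<Rightarrow> 'a tree \<Rightarrow> nat multiset" where
  "leaf_heights_from x h Leaf = {#}"
| "leaf_heights_from x h (Node L y R) =
     (if L = Leaf \<and> R = Leaf then (if y = x then {#h#} else {#})
      else leaf_heights_from x (h - 1) L + leaf_heights_from x (h - 1) R)"

definition leaf_heights :: "'a \<Rightarrow> 'a tree \<Rightarrow> nat multiset" where
  "leaf_heights x T = leaf_heights_from x (tree_height T) T"

end

theory Submission
  imports Defs
begin

text \<open>Everything except the two sums over leaf heights is structural: every tree \<open>T\<^sub>i\<close> consists of
  its predecessor on the left and, on the right, of nothing, a leaf node, or a copy of an earlier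
  tree, so an induction along the construction applies. Two points need more than the construction.
  The root of \<open>T\<^sub>1\<close> is the mean of \<open>p\<close> and \<open>q\<close> only because \<open>p\<close> and \<open>q\<close> are odd and \<open>s 1\<close> differs from both
  (\<open>first_term_mean\<close>). A right subtree is a copy of some \<open>T\<^sub>j\<close>, and it is a left subtree of \<open>T\<close>
  because \<open>T\<^sub>j\<close> is unique.

  The two sums come from unfolding all the averages at once. Moving a leaf one level down halves its
  contribution to the root, so a leaf at height \<open>j\<close> contributes its label with weight \<open>2\<^sup>j\<close> to
  \<open>2\<^sup>l\<close> times the label of the root (\<open>averaging_leaf_weights\<close>). With \<open>P\<close> and \<open>Q\<close> the total weights of
  the leaves labelled \<open>p\<close> and \<open>q\<close>, this says \<open>2\<^sup>l q = p P + q Q\<close>. Coprimality forces \<open>P = k q\<close> and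
  \<open>2\<^sup>l - Q = k p\<close> for some \<open>k\<close>. Here \<open>k > 0\<close>, since the bottom level carries a leaf labelled \<open>p\<close>, and
  \<open>k < 2\<close>, since \<open>k p \<le> 2\<^sup>l < 2 p\<close> for \<open>l = \<lceil>log\<^sub>2 p\<rceil>\<close>. Hence \<open>k = 1\<close> (\<open>coprime_weights_unique\<close>).\<close>

section \<open>Weights of leaf nodes in averaging trees\<close>

definition averaging :: "nat tree \<Rightarrow> bool" where
  "averaging T \<longleftrightarrow> (\<forall>L x R. Node L x R \<in> subtrees T \<longrightarrow>
       (L \<noteq> Leaf \<and> R \<noteq> Leaf \<longrightarrow> 2 * x = value L + value R) \<and>
       (L \<noteq> Leaf \<and> R = Leaf \<longrightarrow> 2 * x = value L) \<and>
       (L = Leaf \<and> R \<noteq> Leaf \<longrightarrow> 2 * x = value R))"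

definition leaf_labels :: "'a tree \<Rightarrow> 'a set" where
  "leaf_labels T = {x. leaf_node x \<in> subtrees T}"

abbreviation leaf_weight :: "'a \<Rightarrow> nat \<Rightarrow> 'a tree \<Rightarrow> nat" where
  "leaf_weight x h T \<equiv> (\<Sum>j\<in>#leaf_heights_from x h T. 2 ^ j)"

lemma averaging_Leaf [simp]: "averaging Leaf"
  by (simp add: averaging_def)

lemma averaging_Node [simp]:
  "averaging (Node L x R) \<longleftrightarrow> averaging L \<and> averaging R \<and>
     (L \<noteq> Leaf \<and> R \<noteq> Leaf \<longrightarrow> 2 * x = value L + value R) \<and>
     (L \<noteq> Leaf \<and> R = Leaf \<longrightarrow> 2 * x = value L) \<and>
     (L = Leaf \<and> R \<noteq> Leaf \<longrightarrow> 2 * x = value R)"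
  unfolding averaging_def by (simp only: tree.set subtrees.simps Un_iff insert_iff tree.inject) blast

lemma leaf_labels_Leaf [simp]: "leaf_labels Leaf = {}"
  by (simp add: leaf_labels_def leaf_node_def)

lemma leaf_labels_Node [simp]:
  "leaf_labels (Node L x R) =
     (if L = Leaf \<and> R = Leaf then {x} else leaf_labels L \<union> leaf_labels R)"
  by (auto simp: leaf_labels_def leaf_node_def)

text \<open>A leaf node at height \<open>h\<close> contributes its label \<open>2 ^ h\<close> times, and one averaging step splits
  this factor evenly between the children. The height bound ensures that the heights of the leaf nodes do not truncate at 0: each
  level down then really halves the weight.\<close>

lemma averaging_leaf_weights:
  assumes "averaging T" "leaf_labels T \<subseteq> {p, q}" "T \<noteq> Leaf" "height T \<le> h + 1" "p \<noteq> q"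
  shows "2 ^ h * value T = p * leaf_weight p h T + q * leaf_weight q h T"
  using assms
proof (induction T arbitrary: h)
  case Leaf
  then show ?case by simp
next
  case (Node L y R)
  show ?case
  proof (cases "L = Leaf \<and> R = Leaf")
    case True
    then show ?thesis using Node.prems by auto
  next
    case False
    then have "h \<noteq> 0" using Node.prems(4) by (intro notI) auto
    then obtain g where g: "h = Suc g" using not0_implies_Suc by blast
    have sub: "leaf_labels L \<subseteq> {p, q}" "leaf_labels R \<subseteq> {p, q}"
      using Node.prems(2) False by auto
    \<comment> \<open>An absent child counts as 0, so that all three forms of averaging read alike.\<close>
    let ?v = "\<lambda>t. if t = Leaf then 0 else value t"
    have L: "2 ^ g * ?v L = p * leaf_weight p g L + q * leaf_weight q g L"
      using Node.IH(1)[of g] Node.prems sub g by auto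
    have R: "2 ^ g * ?v R = p * leaf_weight p g R + q * leaf_weight q g R"
      using Node.IH(2)[of g] Node.prems sub g by auto
    have "2 * y = ?v L + ?v R"
      using Node.prems(1) False by auto
    then have "2 ^ h * y = 2 ^ g * ?v L + 2 ^ g * ?v R"
      unfolding g by (metis distrib_left mult.assoc mult.commute power_Suc)
    also have "\<dots> = p * (leaf_weight p g L + leaf_weight p g R) +
        q * (leaf_weight q g L + leaf_weight q g R)"
      unfolding L R by (simp add: algebra_simps)
    finally show ?thesis using False g by auto
  qed
qed

lemma leaf_weight_pos: "x \<in> leaf_labels T \<Longrightarrow> 0 < leaf_weight x h T"
proof (induction T arbitrary: h)
  case (Node L y R)
  show ?case
  proof (cases "L = Leaf \<and> R = Leaf")
    case False
    then have "x \<in> leaf_labels L \<or> x \<in> leaf_labels R" using Node.prems by auto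
    then have "0 < leaf_weight x (h - 1) L + leaf_weight x (h - 1) R"
      using Node.IH[of "h - 1"] by linarith
    then show ?thesis using False by auto
  qed (use Node.prems in auto)
qed simp

lemma coprime_weights_unique:
  fixes p q N P Q :: nat
  assumes "coprime p q" "0 < q" "N < 2 * p" "0 < P" "N * q = p * P + q * Q"
  shows "P = q" "Q + p = N"
proof -
  have "q dvd p * P"
    using assms(5) by (metis dvd_add_left_iff dvd_triv_left dvd_triv_right)
  then have "q dvd P"
    using assms(1) by (simp add: coprime_commute coprime_dvd_mult_right_iff)
  then obtain k where k: "P = q * k" by blast
  have "q * N = q * (p * k + Q)"
    using assms(5) k by (simp add: algebra_simps)
  then have N: "N = p * k + Q" using assms(2) by simp
  have "p * k < p * 2" using N assms(3) by linarith
  then have "k < 2" by simp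
  moreover have "0 < k" using k assms(4) by simp
  ultimately have "k = 1" by simp
  then show "P = q" "Q + p = N" using k N by auto
qed

section \<open>Shape and labels of the trees\<close>

lemma rep_tree_index_pos: "rep_tree p q s i T \<Longrightarrow> 1 \<le> i"
  by (induction rule: rep_tree.induct) auto

lemma rep_tree_Node: "rep_tree p q s i T \<Longrightarrow> \<exists>L R. T = Node L (s i) R"
  by (induction rule: rep_tree.induct) auto

lemma rep_tree_height: "rep_tree p q s i T \<Longrightarrow> height T = i + 1"
  by (induction rule: rep_tree.induct) (auto simp: leaf_node_def)

lemma rep_tree_left:
  assumes "rep_tree p q s (Suc i) T" "1 \<le> i"
  shows "rep_tree p q s i (left T)"
  using assms by cases auto

lemma rep_tree_left_subtree:
  assumes "rep_tree p q s l T" "1 \<le> i" "i \<le> l"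
  shows "rep_tree p q s i (left_subtree l T i)"
proof -
  have "rep_tree p q s (l - d) ((left ^^ d) T)" if "d < l" for d
    using that
  proof (induction d)
    case (Suc d)
    then have "l - d = Suc (l - Suc d)" by simp
    then show ?case using Suc rep_tree_left[of p q s "l - Suc d" "(left ^^ d) T"] by simp
  qed (simp add: assms(1))
  from this[of "l - i"] show ?thesis using assms by (simp add: left_subtree_def)
qed

lemma rep_tree_leaf_labels: "rep_tree p q s i T \<Longrightarrow> leaf_labels T = {p, q}"
  by (induction rule: rep_tree.induct)
    (auto simp: leaf_node_def dest!: rep_tree_Node)

lemma rep_tree_averaging:
  assumes "rep_tree p q s i T" "2 * s 1 = p + q"
  shows "averaging T"
  using assms
  by (induction rule: rep_tree.induct)
    (auto simp: leaf_node_def dest!: rep_tree_Node)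

lemma right_subtrees_Leaf [simp]: "right_subtrees Leaf = {}"
  by (simp add: right_subtrees_def)

lemma right_subtrees_Node [simp]:
  "right_subtrees (Node L x R) = {R} - {Leaf} \<union> right_subtrees L \<union> right_subtrees R"
  by (auto simp: right_subtrees_def)

lemma rep_tree_right_subtree:
  assumes "rep_tree p q s i T" "R \<in> right_subtrees T"
  shows "(\<exists>x. R = leaf_node x) \<or> (\<exists>j. 1 \<le> j \<and> j \<le> i \<and> rep_tree p q s j R)"
  using assms
proof (induction rule: rep_tree.induct)
  case (avg_tree i T j S)
  from avg_tree.prems consider "R = S" | "R \<in> right_subtrees T" | "R \<in> right_subtrees S"
    by auto
  then show ?case
    using avg_tree.IH avg_tree.hyps by cases (meson le_trans le_add1)+
qed (auto simp: leaf_node_def intro: le_SucI)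

section \<open>The first term and the number of terms\<close>

lemma ceiling_log2_bounds:
  assumes "1 < p" and l: "l = nat \<lceil>log 2 (real p)\<rceil>"
  shows "int l = \<lceil>log 2 (real p)\<rceil>" "p \<le> 2 ^ l" "2 ^ l < 2 * p"
proof -
  show int_l: "int l = \<lceil>log 2 (real p)\<rceil>"
  proof -
    have "0 < log 2 (real p)" using assms(1) by simp
    then show ?thesis using l by simp
  qed
  have p: "real p = 2 powr log 2 (real p)" using assms(1) by simp
  have l_bounds: "log 2 (real p) \<le> real l" "real l < log 2 (real p) + 1"
    using int_l by linarith+
  have "real p \<le> 2 powr real l"
    using p l_bounds(1) by (metis powr_mono one_le_numeral)
  moreover have "2 powr real l < 2 powr (log 2 (real p) + 1)"
    by (rule powr_less_mono) (use l_bounds(2) in simp_all)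
  ultimately
  have "real p \<le> real (2 ^ l)" "real (2 ^ l) < real (2 * p)"
    using assms(1) by (simp_all add: powr_realpow powr_add)
  then show "p \<le> 2 ^ l" "2 ^ l < 2 * p"
    by (simp_all only: of_nat_le_iff of_nat_less_iff)
qed

text \<open>The first term is half the sum of two elements of \<open>{0, p, q}\<close>, one of them odd. Parity excludes
  0; equal summands would give \<open>p\<close>, which no element of the sequence reaches, or \<open>q\<close>, which is the
  last term and, as \<open>l > 1\<close>, not also the first.\<close>

lemma first_term_mean:
  assumes "odd p" "odd q" "0 < q" "q < p" and sorting: "successive_sorting p q A s"
  shows "2 * s 1 = p + q"
proof -
  define l where "l = nat \<lceil>log 2 (real p)\<rceil>"
  note S = sorting[unfolded successive_sorting_def Let_def, folded l_def]
  have "2 < p" using assms(1-4) by (cases "p = 2") auto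
  have l: "2 \<le> l"
  proof (rule ccontr)
    assume "\<not> 2 \<le> l"
    then have "(2::nat) ^ l \<le> 2 ^ 1" by (intro power_increasing) auto
    then show False using ceiling_log2_bounds(2)[of p l] \<open>2 < p\<close> l_def by simp
  qed
  have "s 1 \<noteq> q"
    using S l inj_onD[of s "{1..l}" 1 l] by (auto simp: bij_betw_def)
  have "s 1 \<in> A" using S l by (auto simp: bij_betw_def)
  then have "s 1 < p"
    using mediated_bounds(2)[of A p "s 1"] S assms
    by (auto simp: minimum_mediated_def mediated_containing_def)
  have "\<exists>t\<in>{0, p, q} \<union> s ` {j. 1 \<le> j \<and> j + 2 \<le> 1}. 2 * s 1 = s (1 - 1) + t"
    using S l by (meson atLeastAtMost_iff le_refl one_le_numeral le_trans)
  then obtain t where t: "t \<in> {0, p, q}" "2 * s 1 = s 0 + t" by auto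
  have "s 0 = p \<or> s 0 = q" using S by simp
  moreover have "t \<noteq> 0"
  proof
    assume "t = 0"
    then have "even (s 0)" using t(2) by (metis add_0_right dvd_triv_left)
    then show False using assms(1,2) \<open>s 0 = p \<or> s 0 = q\<close> by auto
  qed
  ultimately show ?thesis
    using t \<open>s 1 \<noteq> q\<close> \<open>s 1 < p\<close> by auto
qed

section \<open>Properties of the binary tree representation\<close>

theorem theorem26:
  fixes p q l :: nat and A :: "nat set" and s :: "nat \<Rightarrow> nat" and T :: "nat tree"
  assumes "odd p" and "odd q" and "0 < q" and "q < p" and "gcd p q = 1"
    and "l = nat \<lceil>log 2 (real p)\<rceil>"
    and "successive_sorting p q A s"
    and "rep_tree p q s l T"
  shows "int (tree_height T) = \<lceil>log 2 (real p)\<rceil> \<and>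
    (\<forall>x. leaf_node x \<in> subtrees T \<longrightarrow> x = p \<or> x = q) \<and>
    root_labelled T q \<and>
    (\<forall>i\<in>{1..l}. root_labelled (left_subtree l T i) (s i)) \<and>
    (\<forall>R\<in>right_subtrees T. (\<exists>x. R = leaf_node x) \<or> (\<exists>i\<in>{1..l}. R = left_subtree l T i)) \<and>
    (\<forall>L x R. Node L x R \<in> subtrees T \<longrightarrow>
       (L \<noteq> Leaf \<and> R \<noteq> Leaf \<longrightarrow> 2 * x = value L + value R) \<and>
       (L \<noteq> Leaf \<and> R = Leaf \<longrightarrow> 2 * x = value L) \<and>
       (L = Leaf \<and> R \<noteq> Leaf \<longrightarrow> 2 * x = value R)) \<and>
    (\<Sum>j\<in>#leaf_heights p T. 2 ^ j) = q \<and>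
    (\<Sum>j\<in>#leaf_heights q T. 2 ^ j) = 2 ^ nat \<lceil>log 2 (real p)\<rceil> - int p"
proof -
  have p: "1 < p" using assms(3,4) by simp
  note bounds = ceiling_log2_bounds[OF p assms(6)]
  note rep = assms(8)
  have "averaging T"
    using rep_tree_averaging[OF rep] first_term_mean[OF assms(1-4,7)] by simp
  have labels: "leaf_labels T = {p, q}" by (rule rep_tree_leaf_labels[OF rep])
  have ht: "tree_height T = l" using rep_tree_height[OF rep] by (simp add: tree_height_def)
  have "s l = q"
    using assms(6,7) by (simp add: successive_sorting_def Let_def)
  then obtain L R where T: "T = Node L q R" using rep_tree_Node[OF rep] by auto
  have left: "rep_tree p q s i (left_subtree l T i)" if "i \<in> {1..l}" for i
    using rep_tree_left_subtree[OF rep] that by simp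
  have right: "(\<exists>x. R = leaf_node x) \<or> (\<exists>i\<in>{1..l}. R = left_subtree l T i)"
    if "R \<in> right_subtrees T" for R
  proof -
    have "R = left_subtree l T j" if "1 \<le> j" "j \<le> l" "rep_tree p q s j R" for j
      using rep_tree_ex1[OF assms(3,4,7), of j] that left[of j] assms(6) by auto
    then show ?thesis
      using rep_tree_right_subtree[OF rep \<open>R \<in> right_subtrees T\<close>] atLeastAtMost_iff by blast
  qed
  let ?P = "leaf_weight p l T" and ?Q = "leaf_weight q l T"
  have "2 ^ l * value T = p * ?P + q * ?Q"
    using rep_tree_height[OF rep] assms(4) labels T
    by (intro averaging_leaf_weights[OF \<open>averaging T\<close>]) simp_all
  then have "2 ^ l * q = p * ?P + q * ?Q"
    using arg_cong[OF T, of "value"] by (simp only: tree.sel)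
  moreover have "0 < ?P" by (rule leaf_weight_pos) (simp add: labels)
  moreover have "coprime p q" using assms(5) by (simp add: coprime_iff_gcd_eq_1)
  ultimately have P: "?P = q" and Q: "?Q + p = 2 ^ l"
    using coprime_weights_unique[of p q "2 ^ l" ?P ?Q] assms(3) bounds(3) by blast+
  have "(\<Sum>j\<in>#M. 2 ^ j) = int (\<Sum>j\<in>#M. 2 ^ j)" for M :: "nat multiset"
    by (induction M) auto
  then have "(\<Sum>j\<in>#leaf_heights_from q l T. 2 ^ j) + int p = int (?Q + p)"
    by (simp only: of_nat_add)
  also have "\<dots> = 2 ^ l" unfolding Q by simp
  finally have Q': "(\<Sum>j\<in>#leaf_heights_from q l T. 2 ^ j) = 2 ^ l - int p" by simp
  show ?thesis
  proof (intro conjI)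
    show "int (tree_height T) = \<lceil>log 2 (real p)\<rceil>" using ht bounds(1) by simp
    show "\<forall>x. leaf_node x \<in> subtrees T \<longrightarrow> x = p \<or> x = q"
      using labels by (auto simp: leaf_labels_def)
    show "root_labelled T q" using T by (simp add: root_labelled_def)
    show "\<forall>i\<in>{1..l}. root_labelled (left_subtree l T i) (s i)"
      unfolding root_labelled_def using rep_tree_Node[OF left] by blast
    show "\<forall>R\<in>right_subtrees T. (\<exists>x. R = leaf_node x) \<or> (\<exists>i\<in>{1..l}. R = left_subtree l T i)"
      using right by blast
    show "\<forall>L x R. Node L x R \<in> subtrees T \<longrightarrow>
       (L \<noteq> Leaf \<and> R \<noteq> Leaf \<longrightarrow> 2 * x = value L + value R) \<and>
       (L \<noteq> Leaf \<and> R = Leaf \<longrightarrow> 2 * x = value L) \<and>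
       (L = Leaf \<and> R \<noteq> Leaf \<longrightarrow> 2 * x = value R)"
      using \<open>averaging T\<close> by (simp only: averaging_def)
    show "(\<Sum>j\<in>#leaf_heights p T. 2 ^ j) = q"
      using P ht by (simp add: leaf_heights_def)
    show "(\<Sum>j\<in>#leaf_heights q T. 2 ^ j) = 2 ^ nat \<lceil>log 2 (real p)\<rceil> - int p"
      using Q' ht assms(6) by (simp add: leaf_heights_def)
  qed
qed

end
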